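(* Let $G$ be a graph with lambda chromatic number $t\geq 3$ and let $C_0,\ldots,C_t$ be the coloured partition of the vertex set of $G$ with respect to an optimal lambda colouring $c:V(G)\to\{0,\ldots,t\}$. Put $l=\max_{0\le m\le t}|C_m|$. Then there exists a graph $G^{*}\in\mathsf{G}(t,l)$ such that $G$ is a subgraph of $G^{*}$.
   Context: All graphs are simple, with finite non-empty vertex set. $d_G(u,v)$ denotes distance in $G$ ($\infty$ if no path joins $u$ and $v$). A lambda colouring of $G$ is a map $c:V(G)\to\mathbb{N}=\{0,1,2,\ldots\}$ with $|c(u)-c(v)|+d_G(u,v)\ge 3$ for all distinct vertices $u,v$, normalised so that $\min_u c(u)=0$. The lambda chromatic number of $G$ is the minimum of $\max_u c(u)$ over all lambda colourings $c$; $c$ is optimal if $\max_u c(u)$ equals the lambda chromatic number. The coloured partition with respect to $c$ is $C_0,\ldots,C_T$, where $T=\max_u c(u)$ and $C_m=\{u: c(u)=m\}$ (some $C_m$ may be empty). For integers $t\ge3$, $l\ge1$, $\mathsf{G}(t,l)$ is the family of graphs $H$ whose vertex set is a disjoint union $V_0\sqcup\cdots\sqcup V_t$ of sets of size $l$ such that: whenever $0\le m\le p-2\le t-2$, the edges between $V_m$ and $V_p$ form a perfect matching (each vertex of one part has exactly one neighbour in the other); no edge has both ends in the same $V_m$; and there are no edges between $V_m$ and $V_{m+1}$. Each such $H$ has exactly $(t+1)l$ vertices and $\binom t2 l$ edges. *)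

theory Defs
  imports "Graph_Theory.Graph_Theory" "HOL-Library.Disjoint_Sets"
begin

text \<open>
  A finite simple graph is a \<^locale>\<open>pair_graph\<close>: a finite loop-free digraph without parallel
  arcs whose arc relation is symmetric. The undirected edge \<open>uv\<close> is the pair of arcs
  \<open>(u, v)\<close> and \<open>(v, u)\<close>.
\<close>

text \<open>
  Graph distance is the shortest-path distance for unit weights; it is \<open>\<infinity>\<close> when no walk joins
  \<open>u\<close> to \<open>v\<close>. The constant is specified only for well-formed digraphs, so it is used below
  only for graphs.
\<close>

definition gdist :: "'a pair_pre_digraph \<Rightarrow> 'a \<Rightarrow> 'a \<Rightarrow> ereal" where
  "gdist G u v = wf_digraph.\<mu> (with_proj G) (\<lambda>_. 1) u v"

text \<open>
  A colouring is a total function on the vertex type; only its values on the vertices of the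
  graph matter.
\<close>

definition lambda_colouring :: "'a pair_pre_digraph \<Rightarrow> ('a \<Rightarrow> nat) \<Rightarrow> bool" where
  "lambda_colouring G c \<longleftrightarrow>
     (\<forall>u\<in>pverts G. \<forall>v\<in>pverts G. u \<noteq> v \<longrightarrow>
        ereal \<bar>real (c u) - real (c v)\<bar> + gdist G u v \<ge> 3) \<and>
     Min (c ` pverts G) = 0"

definition lambda_chromatic_number :: "'a pair_pre_digraph \<Rightarrow> nat" where
  "lambda_chromatic_number G =
     (LEAST k. \<exists>c. lambda_colouring G c \<and> k = Max (c ` pverts G))"

definition optimal_lambda_colouring :: "'a pair_pre_digraph \<Rightarrow> ('a \<Rightarrow> nat) \<Rightarrow> bool" where
  "optimal_lambda_colouring G c \<longleftrightarrow>
     lambda_colouring G c \<and> Max (c ` pverts G) = lambda_chromatic_number G"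

definition colour_class :: "'a pair_pre_digraph \<Rightarrow> ('a \<Rightarrow> nat) \<Rightarrow> nat \<Rightarrow> 'a set" where
  "colour_class G c m = {u \<in> pverts G. c u = m}"

definition perfect_matching_between ::
    "'a pair_pre_digraph \<Rightarrow> 'a set \<Rightarrow> 'a set \<Rightarrow> bool" where
  "perfect_matching_between H A B \<longleftrightarrow>
     (\<forall>u\<in>A. \<exists>!v. v \<in> B \<and> (u, v) \<in> parcs H) \<and>
     (\<forall>v\<in>B. \<exists>!u. u \<in> A \<and> (u, v) \<in> parcs H)"

definition no_edges_between ::
    "'a pair_pre_digraph \<Rightarrow> 'a set \<Rightarrow> 'a set \<Rightarrow> bool" where
  "no_edges_between H A B \<longleftrightarrow> (\<forall>u\<in>A. \<forall>v\<in>B. (u, v) \<notin> parcs H)"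

definition GG :: "nat \<Rightarrow> nat \<Rightarrow> 'a pair_pre_digraph set" where
  "GG t l = {H. 3 \<le> t \<and> 1 \<le> l \<and> pair_graph H \<and>
     (\<exists>V :: nat \<Rightarrow> 'a set.
        pverts H = (\<Union>m\<in>{0..t}. V m) \<and>
        disjoint_family_on V {0..t} \<and>
        (\<forall>m\<in>{0..t}. finite (V m) \<and> card (V m) = l) \<and>
        (\<forall>m p. m + 2 \<le> p \<and> p \<le> t \<longrightarrow> perfect_matching_between H (V m) (V p)) \<and>
        (\<forall>m\<in>{0..t}. no_edges_between H (V m) (V m)) \<and>
        (\<forall>m<t. no_edges_between H (V m) (V (Suc m))))}"

text \<open>
  Transport of a graph along an injective relabelling of its vertices. A supergraph may need
  more vertices than the vertex type \<open>'a\<close> has, so supergraphs of a graph over \<open>'a\<close> are taken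
  over \<^typ>\<open>'a + nat\<close>, where \<open>relabel Inl G\<close> is the canonical copy of \<open>G\<close>.
\<close>

definition relabel :: "('a \<Rightarrow> 'b) \<Rightarrow> 'a pair_pre_digraph \<Rightarrow> 'b pair_pre_digraph" where
  "relabel f G = \<lparr> pverts = f ` pverts G, parcs = map_prod f f ` parcs G \<rparr>"

end

theory Submission
  imports Defs "HOL-Library.Countable"
begin

text \<open>
  A lambda colouring leaves few possibilities for the edges of a graph. Two neighbours have
  distance at most \<open>1\<close>, so their colours differ by at least \<open>2\<close>; two distinct vertices with a
  common neighbour have distance at most \<open>2\<close>, so their colours differ. Hence there are no edges
  inside a colour class or between consecutive classes, and between any two other classes the
  edges form a partial matching, because no vertex has two neighbours of the same colour.

  A graph with this structure is completed to a member of \<^term>\<open>GG t l\<close> in two steps.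
  Every class is padded with new isolated vertices to the size \<open>l\<close> of the largest one
  (\<open>pad_family\<close>), which preserves the structure above. Then each partial matching between two
  classes of the same size \<open>l\<close> is extended to a perfect one (\<open>extend_partial_matching\<close>). The pairs
  of classes do not interact, since no condition in the definition of \<^term>\<open>GG t l\<close> concerns more
  than two classes; this is \<open>GG_completion\<close>.
\<close>

section \<open>Distances of neighbours and of vertices with a common neighbour\<close>

lemma gdist_arc_le:
  assumes "pair_graph G" and "(u, v) \<in> parcs G"
  shows "gdist G u v \<le> 1"
proof -
  interpret pair_graph G by fact
  have "awalk u [(u, v)] v"
    using assms(2) by (auto simp: awalk_simps dest: wellformed')
  from min_cost_le_walk_cost[OF this, of "\<lambda>_. 1"] show ?thesis
    by (simp add: gdist_def one_ereal_def)
qed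

lemma gdist_two_arcs_le:
  assumes "pair_graph G" and "(u, v) \<in> parcs G" and "(v, w) \<in> parcs G"
  shows "gdist G u w \<le> 2"
proof -
  interpret pair_graph G by fact
  have "awalk u [(u, v), (v, w)] w"
    using assms(2,3) by (auto simp: awalk_simps dest: wellformed')
  from min_cost_le_walk_cost[OF this, of "\<lambda>_. 1"] show ?thesis
    by (simp add: gdist_def)
qed

lemma lambda_colouring_arc:
  assumes "pair_graph G" and "lambda_colouring G c" and "(u, v) \<in> parcs G"
  shows "c u + 2 \<le> c v \<or> c v + 2 \<le> c u"
proof -
  interpret pair_graph G by fact
  have "u \<in> pverts G" "v \<in> pverts G" "u \<noteq> v"
    using assms(3) wellformed' no_loops' by blast+
  then have "3 \<le> ereal \<bar>real (c u) - real (c v)\<bar> + gdist G u v"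
    using assms(2) by (auto simp: lambda_colouring_def)
  also have "\<dots> \<le> ereal \<bar>real (c u) - real (c v)\<bar> + 1"
    by (intro add_left_mono gdist_arc_le assms)
  finally have "ereal 3 \<le> ereal (\<bar>real (c u) - real (c v)\<bar> + 1)"
    by (simp add: one_ereal_def)
  then have "3 \<le> \<bar>real (c u) - real (c v)\<bar> + 1"
    by (simp only: ereal_less_eq)
  then show ?thesis by linarith
qed

lemma lambda_colouring_common_neighbour:
  assumes "pair_graph G" and "lambda_colouring G c"
    and "(u, v) \<in> parcs G" and "(u, w) \<in> parcs G" and "c v = c w"
  shows "v = w"
proof (rule ccontr)
  assume "v \<noteq> w"
  interpret pair_graph G by fact
  have vu: "(v, u) \<in> parcs G"
    using assms(3) by (rule arcs_symmetric)
  have "v \<in> pverts G" "w \<in> pverts G"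
    using assms(3,4) wellformed' by blast+
  then have "3 \<le> ereal \<bar>real (c v) - real (c w)\<bar> + gdist G v w"
    using assms(2) \<open>v \<noteq> w\<close> unfolding lambda_colouring_def by blast
  also have "\<dots> = gdist G v w"
    using assms(5) by (simp flip: zero_ereal_def)
  also have "\<dots> \<le> 2"
    by (rule gdist_two_arcs_le[OF assms(1) vu assms(4)])
  finally show False by simp
qed

section \<open>Padding the classes and completing the matchings\<close>

lemma extend_partial_matching:
  assumes "finite A" and "finite B" and "card A = card B" and "R \<subseteq> A \<times> B"
    and "\<And>a b b'. (a, b) \<in> R \<Longrightarrow> (a, b') \<in> R \<Longrightarrow> b = b'"
    and "\<And>a a' b. (a, b) \<in> R \<Longrightarrow> (a', b) \<in> R \<Longrightarrow> a = a'"
  obtains f where "bij_betw f A B" and "\<And>a b. (a, b) \<in> R \<Longrightarrow> f a = b"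
proof -
  define g where "g a = (THE b. (a, b) \<in> R)" for a
  have g: "g a = b" if "(a, b) \<in> R" for a b
    unfolding g_def using that assms(5) by blast
  have bij_g: "bij_betw g (Domain R) (Range R)"
    unfolding bij_betw_def
  proof
    show "inj_on g (Domain R)"
      by (rule inj_onI) (metis DomainE assms(6) g)
    show "g ` Domain R = Range R"
      using g by force
  qed
  have sub: "Domain R \<subseteq> A" "Range R \<subseteq> B"
    using assms(4) by auto
  \<comment> \<open>The unmatched vertices on both sides are equally many, so any bijection between them
      completes the matching.\<close>
  have "card (A - Domain R) = card (B - Range R)"
    using sub assms(1-3) bij_betw_same_card[OF bij_g]
    by (simp add: card_Diff_subset finite_subset)
  then obtain h where h: "bij_betw h (A - Domain R) (B - Range R)"
    using assms(1,2) finite_same_card_bij by (metis finite_Diff)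
  define f where "f a = (if a \<in> Domain R then g a else h a)" for a
  have "bij_betw f (Domain R \<union> (A - Domain R)) (Range R \<union> (B - Range R))"
  proof (rule bij_betw_combine)
    show "bij_betw f (Domain R) (Range R)"
      using bij_g by (simp add: f_def cong: bij_betw_cong)
    have "bij_betw f (A - Domain R) (B - Range R) = bij_betw h (A - Domain R) (B - Range R)"
      by (rule bij_betw_cong) (simp add: f_def)
    with h show "bij_betw f (A - Domain R) (B - Range R)" by simp
  qed auto
  then have "bij_betw f A B"
    using sub by (simp add: Un_absorb1)
  moreover have "f a = b" if "(a, b) \<in> R" for a b
    using that g by (auto simp: f_def)
  ultimately show thesis by (rule that)
qed

text \<open>
  The padding vertices come from the second summand; encoding the index of the class into them
  keeps those of different classes apart.
\<close>

lemma pad_family: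
  fixes C :: "'i::countable \<Rightarrow> 'a set"
  assumes "disjoint_family_on C I" and "\<And>m. m \<in> I \<Longrightarrow> finite (C m)"
    and "\<And>m. m \<in> I \<Longrightarrow> card (C m) \<le> l"
  obtains V :: "'i \<Rightarrow> ('a + nat) set"
  where "disjoint_family_on V I"
    and "\<And>m. m \<in> I \<Longrightarrow> finite (V m) \<and> card (V m) = l"
    and "\<And>m x. Inl x \<in> V m \<longleftrightarrow> x \<in> C m"
proof -
  define P :: "'i \<Rightarrow> nat set"
    where "P m = (\<lambda>i. prod_encode (to_nat m, i)) ` {..<l - card (C m)}" for m
  define V where "V m = C m <+> P m" for m
  have cardP: "card (P m) = l - card (C m)" for m
    unfolding P_def by (subst card_image) (auto intro: inj_onI)
  have "disjoint_family_on V I"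
    using assms(1) by (fastforce simp: disjoint_family_on_def V_def P_def)
  moreover have "finite (V m) \<and> card (V m) = l" if "m \<in> I" for m
  proof -
    have "finite (P m)" by (simp add: P_def)
    then show ?thesis
      using assms(2,3)[OF that] by (simp add: V_def card_Plus cardP)
  qed
  moreover have "Inl x \<in> V m \<longleftrightarrow> x \<in> C m" for m x
    by (auto simp: V_def)
  ultimately show thesis by (rule that)
qed

text \<open>
  Colours are gone here: what they leave behind is that edges join only pairs of classes that
  need a matching, and that these edges already form partial matchings. Each of these can be made
  perfect on its own. Since \<^term>\<open>H\<close> is symmetric, the hypothesis on common neighbours covers both
  sides of each pair of classes.
\<close>

lemma GG_completion:
  fixes H :: "'b pair_pre_digraph" and V :: "nat \<Rightarrow> 'b set"
  assumes "3 \<le> t" and "1 \<le> l" and "pair_graph H"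
    and verts: "pverts H \<subseteq> (\<Union>m\<in>{0..t}. V m)"
    and disj: "disjoint_family_on V {0..t}"
    and fin: "\<And>m. m \<le> t \<Longrightarrow> finite (V m)"
    and card: "\<And>m. m \<le> t \<Longrightarrow> card (V m) = l"
    and far: "\<And>m p u v. \<lbrakk>(u, v) \<in> parcs H; m \<le> t; p \<le> t; u \<in> V m; v \<in> V p\<rbrakk>
                \<Longrightarrow> m + 2 \<le> p \<or> p + 2 \<le> m"
    and match: "\<And>p u v w. \<lbrakk>(u, v) \<in> parcs H; (u, w) \<in> parcs H; p \<le> t; v \<in> V p; w \<in> V p\<rbrakk>
                \<Longrightarrow> v = w"
  shows "\<exists>Gs \<in> GG t l. subgraph (with_proj H) (with_proj Gs)"
proof -
  interpret H: pair_graph H by fact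
  have uniq: "m = p" if "u \<in> V m" "u \<in> V p" "m \<le> t" "p \<le> t" for u m p
    using disjoint_family_onD[OF disj, of m p] that by auto
  have "\<exists>f. bij_betw f (V m) (V p) \<and>
          (\<forall>u v. (u, v) \<in> parcs H \<longrightarrow> u \<in> V m \<longrightarrow> v \<in> V p \<longrightarrow> f u = v)"
    if "m \<le> t" "p \<le> t" for m p
  proof -
    obtain f where "bij_betw f (V m) (V p)"
      and "\<And>u v. (u, v) \<in> parcs H \<inter> V m \<times> V p \<Longrightarrow> f u = v"
    proof (rule extend_partial_matching)
      show "finite (V m)" "finite (V p)" "card (V m) = card (V p)"
        using fin card \<open>m \<le> t\<close> \<open>p \<le> t\<close> by simp_all
      show "parcs H \<inter> V m \<times> V p \<subseteq> V m \<times> V p" by blast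
      show "b = b'" if "(a, b) \<in> parcs H \<inter> V m \<times> V p" "(a, b') \<in> parcs H \<inter> V m \<times> V p"
        for a b b'
        using that match \<open>p \<le> t\<close> by blast
      show "a = a'" if "(a, b) \<in> parcs H \<inter> V m \<times> V p" "(a', b) \<in> parcs H \<inter> V m \<times> V p"
        for a a' b
        using that match[of b a a' m] \<open>m \<le> t\<close> by (auto dest: H.arcs_symmetric)
    qed (rule that)
    then show ?thesis by blast
  qed
  then obtain f where
    bij: "\<And>m p. m \<le> t \<Longrightarrow> p \<le> t \<Longrightarrow> bij_betw (f m p) (V m) (V p)" and
    ext: "\<And>m p u v. \<lbrakk>m \<le> t; p \<le> t; (u, v) \<in> parcs H; u \<in> V m; v \<in> V p\<rbrakk> \<Longrightarrow> f m p u = v"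
    by metis
  \<comment> \<open>Only the bijections with increasing indices are used, so that the two directions of an edge
      come from the same bijection; disjointness of the classes makes the pair of indices of an
      edge, and hence the bijection, unique.\<close>
  define E where "E = {(u, f m p u) | m p u. m + 2 \<le> p \<and> p \<le> t \<and> u \<in> V m}"
  define Gs where "Gs = \<lparr>pverts = (\<Union>m\<in>{0..t}. V m), parcs = E \<union> E\<inverse>\<rparr>"
  have E: "\<exists>m p. m + 2 \<le> p \<and> p \<le> t \<and> u \<in> V m \<and> v \<in> V p \<and> v = f m p u"
    if "(u, v) \<in> E" for u v
    using that bij unfolding E_def
    by clarsimp (metis bij_betwE le_trans nat_le_linear not_less_eq_eq le_SucI)
  have arcs: "(u, v) \<in> parcs Gs \<longleftrightarrow> v = f m p u"
    if "m + 2 \<le> p" "p \<le> t" "u \<in> V m" "v \<in> V p" for m p u v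
  proof
    assume "v = f m p u"
    with that show "(u, v) \<in> parcs Gs" by (auto simp: Gs_def E_def)
  next
    assume "(u, v) \<in> parcs Gs"
    then consider "(u, v) \<in> E" | "(v, u) \<in> E" by (auto simp: Gs_def)
    then show "v = f m p u"
    proof cases
      case 1
      then obtain m' p' where "m' + 2 \<le> p'" "p' \<le> t" "u \<in> V m'" "v \<in> V p'" "v = f m' p' u"
        using E by blast
      with that uniq[of u m m'] uniq[of v p p'] show ?thesis by simp
    next
      case 2
      then obtain m' p' where "m' + 2 \<le> p'" "p' \<le> t" "v \<in> V m'" "u \<in> V p'"
        using E by blast
      with that uniq[of u m p'] uniq[of v p m'] show ?thesis by simp
    qed
  qed
  have near: "(u, v) \<notin> parcs Gs"
    if "m \<le> t" "p \<le> t" "u \<in> V m" "v \<in> V p" "m < p + 2" "p < m + 2" for m p u v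
  proof
    assume "(u, v) \<in> parcs Gs"
    then consider "(u, v) \<in> E" | "(v, u) \<in> E" by (auto simp: Gs_def)
    then show False
    proof cases
      case 1
      then obtain m' p' where "m' + 2 \<le> p'" "p' \<le> t" "u \<in> V m'" "v \<in> V p'"
        using E by blast
      with that uniq[of u m m'] uniq[of v p p'] show False by simp
    next
      case 2
      then obtain m' p' where "m' + 2 \<le> p'" "p' \<le> t" "v \<in> V m'" "u \<in> V p'"
        using E by blast
      with that uniq[of u m p'] uniq[of v p m'] show False by simp
    qed
  qed
  have wf_E: "u \<in> pverts Gs \<and> v \<in> pverts Gs \<and> u \<noteq> v" if uv: "(u, v) \<in> E" for u v
  proof -
    obtain m p where *: "m + 2 \<le> p" "p \<le> t" "u \<in> V m" "v \<in> V p"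
      using E[OF uv] by blast
    then have "u \<noteq> v" using uniq[of u m p] by auto
    moreover have "m \<in> {0..t}" "p \<in> {0..t}" using * by auto
    ultimately show ?thesis using * by (auto simp: Gs_def)
  qed
  have fin_verts: "finite (pverts Gs)"
    using fin by (auto simp: Gs_def)
  have "parcs Gs \<subseteq> pverts Gs \<times> pverts Gs"
    using wf_E by (auto simp: Gs_def)
  then have fin_arcs: "finite (parcs Gs)"
    using fin_verts by (meson finite_SigmaI finite_subset)
  have no_loop: "(u, u) \<notin> E" for u
    using wf_E by blast
  have graph: "pair_graph Gs"
  proof
    show "symmetric (with_proj Gs)"
      by (auto simp: symmetric_def Gs_def intro!: symI)
  qed (use wf_E fin_verts fin_arcs no_loop in \<open>auto simp: Gs_def\<close>)
  have perfect: "perfect_matching_between Gs (V m) (V p)" if "m + 2 \<le> p" "p \<le> t" for m p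
  proof -
    have b: "bij_betw (f m p) (V m) (V p)"
      using bij that by simp
    have "\<exists>!v. v \<in> V p \<and> (u, v) \<in> parcs Gs" if "u \<in> V m" for u
      using arcs[OF \<open>m + 2 \<le> p\<close> \<open>p \<le> t\<close> that] bij_betwE[OF b] that by metis
    moreover have "\<exists>!u. u \<in> V m \<and> (u, v) \<in> parcs Gs" if v: "v \<in> V p" for v
    proof -
      note arc_iff = arcs[OF \<open>m + 2 \<le> p\<close> \<open>p \<le> t\<close> _ v]
      obtain u where u: "u \<in> V m" "v = f m p u"
        using bij_betw_imp_surj_on[OF b] v by blast
      show ?thesis
      proof (rule ex1I)
        show "u \<in> V m \<and> (u, v) \<in> parcs Gs"
          using u arc_iff by blast
        show "u' = u" if "u' \<in> V m \<and> (u', v) \<in> parcs Gs" for u'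
          using that u arc_iff inj_onD[OF bij_betw_imp_inj_on[OF b]] by metis
      qed
    qed
    ultimately show ?thesis by (simp add: perfect_matching_between_def)
  qed
  have "Gs \<in> GG t l"
  proof -
    have "pverts Gs = (\<Union>m\<in>{0..t}. V m)" by (simp add: Gs_def)
    moreover have "no_edges_between Gs (V m) (V m)" if "m \<in> {0..t}" for m
      using that near[of m m] by (simp add: no_edges_between_def)
    moreover have "no_edges_between Gs (V m) (V (Suc m))" if "m < t" for m
      using that near[of m "Suc m"] by (simp add: no_edges_between_def)
    ultimately show ?thesis
      unfolding GG_def using assms(1,2) graph disj fin card perfect
      by (intro CollectI conjI exI[of _ V]) simp_all
  qed
  moreover have "parcs H \<subseteq> parcs Gs"
  proof
    fix e assume "e \<in> parcs H"
    then obtain u v where e: "e = (u, v)" "(u, v) \<in> parcs H" by (cases e) auto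
    then obtain m p where mp: "m \<le> t" "p \<le> t" "u \<in> V m" "v \<in> V p"
      using verts H.wellformed' by (metis UN_E atLeastAtMost_iff subsetD)
    from far[OF e(2) mp] show "e \<in> parcs Gs"
    proof
      assume "m + 2 \<le> p"
      then show ?thesis
        using arcs[of m p u v] ext[OF mp(1,2) e(2) mp(3,4)] mp e(1) by simp
    next
      assume "p + 2 \<le> m"
      then have "(v, u) \<in> parcs Gs"
        using arcs[of p m v u] ext[OF mp(2,1) H.arcs_symmetric[OF e(2)] mp(4,3)] mp by simp
      then show ?thesis using e(1) by (auto simp: Gs_def)
    qed
  qed
  then have "subgraph (with_proj H) (with_proj Gs)"
    using verts graph H.wf_digraph_axioms
    by (auto simp: subgraph_def compatible_def wf_digraph_wp_iff Gs_def
        pair_graph_def pair_digraph_def pair_fin_digraph_def)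
  ultimately show ?thesis by blast
qed

lemma pair_graph_relabel:
  assumes "pair_graph G" and "inj f"
  shows "pair_graph (relabel f G)"
proof -
  interpret pair_graph G by fact
  show ?thesis
  proof
    show "symmetric (with_proj (relabel f G))"
      by (auto simp: symmetric_def relabel_def intro!: symI dest: arcs_symmetric)
  qed (use assms(2) in \<open>auto simp: relabel_def pair_finite_verts pair_finite_arcs inj_eq
        dest: wellformed' no_loops'\<close>)
qed

section \<open>Completing a coloured graph\<close>

theorem theorem2p8:
  fixes G :: "'a pair_pre_digraph" and c :: "'a \<Rightarrow> nat" and t l :: nat
  assumes "pair_graph G" and "pverts G \<noteq> {}"
    and "lambda_chromatic_number G = t" and "t \<ge> 3"
    and "optimal_lambda_colouring G c"
    and "l = Max ((\<lambda>m. card (colour_class G c m)) ` {0..t})"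
  shows "\<exists>Gs :: ('a + nat) pair_pre_digraph.
           Gs \<in> GG t l \<and> subgraph (with_proj (relabel Inl G)) (with_proj Gs)"
proof -
  interpret pair_graph G by fact
  have col: "lambda_colouring G c" and top: "Max (c ` pverts G) = t"
    using assms(3,5) by (auto simp: optimal_lambda_colouring_def)
  have le_t: "c u \<le> t" if "u \<in> pverts G" for u
    using that top pair_finite_verts by (metis Max_ge finite_imageI imageI)
  have fin: "finite (colour_class G c m)" for m
    using pair_finite_verts by (simp add: colour_class_def)
  have le_l: "card (colour_class G c m) \<le> l" if "m \<in> {0..t}" for m
    using that assms(6) by (metis Max_ge finite_atLeastAtMost finite_imageI imageI)
  obtain u where u: "u \<in> pverts G" using assms(2) by blast
  then have "u \<in> colour_class G c (c u)" by (simp add: colour_class_def)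
  then have "1 \<le> card (colour_class G c (c u))"
    using fin by (metis One_nat_def Suc_leI card_gt_0_iff empty_iff)
  also have "\<dots> \<le> l" using le_l le_t[OF u] by simp
  finally have "1 \<le> l" .
  have "disjoint_family_on (colour_class G c) {0..t}"
    by (auto simp: disjoint_family_on_def colour_class_def)
  then obtain V :: "nat \<Rightarrow> ('a + nat) set" where
    V: "disjoint_family_on V {0..t}"
      "\<And>m. m \<in> {0..t} \<Longrightarrow> finite (V m) \<and> card (V m) = l"
      "\<And>m x. Inl x \<in> V m \<longleftrightarrow> x \<in> colour_class G c m"
  proof (rule pad_family[where C = "colour_class G c" and l = l])
    show "finite (colour_class G c m)" for m by (rule fin)
    show "card (colour_class G c m) \<le> l" if "m \<in> {0..t}" for m using that by (rule le_l)
  qed (rule that)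
  have "\<exists>Gs \<in> (GG t l :: ('a + nat) pair_pre_digraph set).
          subgraph (with_proj (relabel Inl G)) (with_proj Gs)"
  proof (rule GG_completion)
    show "pair_graph (relabel Inl G)"
      using assms(1) by (rule pair_graph_relabel) simp
    show "pverts (relabel Inl G) \<subseteq> (\<Union>m\<in>{0..t}. V m)"
      using le_t V(3) by (auto simp: relabel_def colour_class_def)
  next
    fix m p x y
    assume "(x, y) \<in> parcs (relabel Inl G)" "x \<in> V m" "y \<in> V p"
    then obtain a b where "(a, b) \<in> parcs G" "c a = m" "c b = p"
      using V(3) by (auto simp: relabel_def colour_class_def)
    then show "m + 2 \<le> p \<or> p + 2 \<le> m"
      using lambda_colouring_arc[OF assms(1) col] by blast
  next
    fix p x y z
    assume "(x, y) \<in> parcs (relabel Inl G)" "(x, z) \<in> parcs (relabel Inl G)"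
      and "y \<in> V p" "z \<in> V p"
    then show "y = z"
      using V(3) lambda_colouring_common_neighbour[OF assms(1) col]
      by (auto simp: relabel_def colour_class_def)
  qed (use assms(4) \<open>1 \<le> l\<close> V in auto)
  then show ?thesis by blast
qed

end
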